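(* Suppose $h\equiv 0\pmod 4$ and there exists a Hadamard matrix of order $h$. If $s\equiv 3\pmod 4$ is a prime power, then there exists a plan orthogonal through a pair of factors (POTP) for an $s^{2h}$ experiment on $2hs(s-1)/2$ runs.
   Context: An $s^m$ experiment has $m$ treatment factors, each with $s$ levels (no block factor here). A plan on $n$ runs is a list of $n$ runs (repetitions allowed), each run assigning a level to each factor. The general effect is viewed as an additional one-level factor $G$. The design matrix $X_A$ of a factor $A$ is the $n\times s$ matrix with $(u,t)$ entry $1$ if run $u$ has $A$ at level $t$ and $0$ otherwise ($X_G=1_n$). For a set $T$ of factors, $X_T=[X_B:B\in T]$ and $P_T$ is the orthogonal projector onto the column space of $X_T$. Two factors $A,B\notin T$ are orthogonal through $T$ if $X_A'(I-P_T)X_B=0$. A plan is a plan orthogonal through a pair of factors (POTP) if there is a set $T$ of two factors such that $A$ and $B$ are orthogonal through $T$ for all $A\ne B$ with $A,B\notin T$. Standing assumption: all plans considered are connected, i.e. for every factor $A$, the matrix $C_A=X_A'(I-P_{\bar A})X_A$, where $\bar A$ is the set of all factors (including $G$) other than $A$, has rank $s_A-1$, where $s_A$ is the number of levels of $A$. *)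

theory Defs
  imports
    "HOL-Library.Option_ord"
    "HOL-Number_Theory.Cong"
    "HOL-Number_Theory.Prime_Powers"
    "Jordan_Normal_Form.DL_Rank"
begin

definition hadamard :: "nat \<Rightarrow> int mat \<Rightarrow> bool" where
  "hadamard h H \<longleftrightarrow> H \<in> carrier_mat h h \<and>
     (\<forall>i<h. \<forall>j<h. H $$ (i,j) = 1 \<or> H $$ (i,j) = -1) \<and>
     H * H\<^sup>T = of_nat h \<cdot>\<^sub>m 1\<^sub>m h"

text \<open>A run is the list of the levels of the treatment factors, a plan is a list of runs.\<close>

type_synonym plan = "nat list list"

definition is_plan :: "nat \<Rightarrow> nat \<Rightarrow> plan \<Rightarrow> bool" where
  "is_plan s m D \<longleftrightarrow> (\<forall>r\<in>set D. length r = m \<and> (\<forall>t\<in>set r. t < s))"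

text \<open>\<open>None\<close> is the general effect, \<open>Some i\<close> is the \<open>i\<close>-th treatment factor.\<close>

type_synonym factor = "nat option"

definition treatment_factors :: "nat \<Rightarrow> factor set" where
  "treatment_factors m = Some ` {..<m}"

definition all_factors :: "nat \<Rightarrow> factor set" where
  "all_factors m = insert None (treatment_factors m)"

fun levels :: "nat \<Rightarrow> factor \<Rightarrow> nat" where
  "levels s None = 1"
| "levels s (Some i) = s"

fun level_of :: "plan \<Rightarrow> nat \<Rightarrow> factor \<Rightarrow> nat" where
  "level_of D u None = 0"
| "level_of D u (Some i) = D ! u ! i"

definition design_mat :: "nat \<Rightarrow> plan \<Rightarrow> factor \<Rightarrow> real mat" where
  "design_mat s D A =
     mat (length D) (levels s A) (\<lambda>(u,t). if level_of D u A = t then 1 else 0)"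

text \<open>The blocks are placed side by side in increasing order of the labels of the factors;
  only the column space of the result is used. \<open>T\<close> is meant to be finite.\<close>

definition design_mat_set :: "nat \<Rightarrow> plan \<Rightarrow> factor set \<Rightarrow> real mat" where
  "design_mat_set s D T =
     mat_of_cols (length D) (concat (map (\<lambda>B. cols (design_mat s D B)) (sorted_list_of_set T)))"

definition is_orth_projector :: "real mat \<Rightarrow> real mat \<Rightarrow> bool" where
  "is_orth_projector X P \<longleftrightarrow>
     P \<in> carrier_mat (dim_row X) (dim_row X) \<and> P\<^sup>T = P \<and> P * P = P \<and>
     vec_space.col_space (dim_row X) P = vec_space.col_space (dim_row X) X"

definition orth_projector :: "real mat \<Rightarrow> real mat" where
  "orth_projector X = (THE P. is_orth_projector X P)"

definition proj :: "nat \<Rightarrow> plan \<Rightarrow> factor set \<Rightarrow> real mat" where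
  "proj s D T = orth_projector (design_mat_set s D T)"

definition orthogonal_through :: "nat \<Rightarrow> plan \<Rightarrow> factor set \<Rightarrow> factor \<Rightarrow> factor \<Rightarrow> bool" where
  "orthogonal_through s D T A B \<longleftrightarrow>
     (design_mat s D A)\<^sup>T * (1\<^sub>m (length D) - proj s D T) * design_mat s D B =
       0\<^sub>m (levels s A) (levels s B)"

definition C_mat :: "nat \<Rightarrow> nat \<Rightarrow> plan \<Rightarrow> factor \<Rightarrow> real mat" where
  "C_mat s m D A =
     (design_mat s D A)\<^sup>T * (1\<^sub>m (length D) - proj s D (all_factors m - {A})) * design_mat s D A"

definition connected_plan :: "nat \<Rightarrow> nat \<Rightarrow> plan \<Rightarrow> bool" where
  "connected_plan s m D \<longleftrightarrow>
     (\<forall>A\<in>all_factors m. vec_space.rank (levels s A) (C_mat s m D A) = levels s A - 1)"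

text \<open>The pair \<open>T\<close> consists of treatment factors. The condition on \<open>A\<close> and \<open>B\<close> includes the
  general effect, for which it is automatic, since \<open>1\<^sub>n\<close> lies in the column space of \<open>X\<^sub>T\<close>.\<close>

definition potp :: "nat \<Rightarrow> nat \<Rightarrow> plan \<Rightarrow> bool" where
  "potp s m D \<longleftrightarrow>
     (\<exists>T \<subseteq> treatment_factors m. card T = 2 \<and>
        (\<forall>A\<in>all_factors m - T. \<forall>B\<in>all_factors m - T. A \<noteq> B \<longrightarrow> orthogonal_through s D T A B))"

end

theory Submission
  imports Defs
begin

text \<open>The construction takes all ordered pairs \<open>(x, y)\<close> of distinct levels and repeats them once for each
column \<open>k\<close> of a Hadamard matrix of order \<open>h\<close>. In the run \<open>(k, x, y)\<close> every factor has
either the level \<open>x\<close> or the level \<open>y\<close>: the factor \<open>0\<close> always takes \<open>x\<close>, the factor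
\<open>1\<close> always takes \<open>y\<close>, and each of the other \<open>h - 1\<close> rows of the matrix, normalised so that its
row \<open>0\<close> is constant, provides two factors \<open>2 * i\<close> and \<open>2 * i + 1\<close>. The first of them chooses
between \<open>x\<close> and \<open>y\<close> by the sign \<open>\<epsilon>\<close> of the entry \<open>(i, k)\<close>; the second
one reverses this choice when \<open>y < x\<close>. The number of runs is \<open>h * (s * (s - 1))\<close>.

A function \<open>F\<close> of the level of a factor is then \<open>(F x + F y) / 2 + \<epsilon> * (F x - F y) / 2\<close>.
The first summand is a function of \<open>x\<close> plus a function of \<open>y\<close>, so it lies in the column space
of \<open>X\<^sub>T\<close> for the pair \<open>T\<close> of the factors \<open>0\<close> and \<open>1\<close>. For the other
factors the second summand is orthogonal to that space, because a row of the Hadamard matrix sums to \<open>0\<close>.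
So it is the residual modulo \<open>T\<close>, and \<open>T\<close> works as the required pair: residuals of factors
from different rows are orthogonal because the rows are, and the two factors of one row have orthogonal
residuals because the product of their signs changes sign under the exchange of \<open>x\<close> and
\<open>y\<close>, while the rest of the product does not (\<open>residuals_orthogonal\<close>).

Connectedness says that the only linear relations between the factor spaces are those between the constants.
Correlating a relation with row \<open>i\<close> of the Hadamard matrix isolates the two factors of that row
at fixed \<open>x\<close> and \<open>y\<close>, and the exchange of \<open>x\<close> and \<open>y\<close> separates them; what is
left for row \<open>0\<close> is \<open>G\<^sub>0 x + G\<^sub>1 y = const\<close> for \<open>x \<noteq> y\<close>. As
\<open>s \<equiv> 3\<close> modulo \<open>4\<close>, there are at least three levels, and this makes \<open>G\<^sub>0\<close> and \<open>G\<^sub>1\<close> constant (\<open>additive_relation_trivial\<close>).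

Orthogonal projectors exist and are unique, so both properties of the plan reduce to statements about functions
on the runs (\<open>orthogonal_throughI\<close>, \<open>connected_planI\<close>).\<close>

section \<open>Orthogonal projectors\<close>

lemma mat_eqI_mult_vec:
  assumes A: "A \<in> carrier_mat n m" and B: "B \<in> carrier_mat n m"
    and eq: "\<And>v. v \<in> carrier_vec m \<Longrightarrow> A *\<^sub>v v = B *\<^sub>v (v :: 'a :: semiring_1 vec)"
  shows "A = B"
proof (rule eq_matI)
  fix i j assume "i < dim_row B" "j < dim_col B"
  then have i: "i < n" and j: "j < m" using B by auto
  have "(A *\<^sub>v unit_vec m j) $ i = (B *\<^sub>v unit_vec m j) $ i"
    using eq[of "unit_vec m j"] by simp
  then show "A $$ (i,j) = B $$ (i,j)"
    using A B i j by simp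
qed (use A B in auto)

lemma mat_of_cols_append_mult_vec:
  assumes "set xs \<subseteq> carrier_vec n" "set ys \<subseteq> carrier_vec n"
    and a: "a \<in> carrier_vec (length xs)" and b: "b \<in> carrier_vec (length ys)"
  shows "mat_of_cols n (xs @ ys) *\<^sub>v (a @\<^sub>v b) =
    mat_of_cols n xs *\<^sub>v a + mat_of_cols n ys *\<^sub>v (b :: 'a :: comm_semiring_0 vec)"
proof (rule eq_vecI)
  fix u assume "u < dim_vec (mat_of_cols n xs *\<^sub>v a + mat_of_cols n ys *\<^sub>v b)"
  then have u: "u < n" by simp
  have "row (mat_of_cols n (xs @ ys)) u = row (mat_of_cols n xs) u @\<^sub>v row (mat_of_cols n ys) u"
    using u by (intro eq_vecI) (auto simp: mat_of_cols_index nth_append)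
  then have "(mat_of_cols n (xs @ ys) *\<^sub>v (a @\<^sub>v b)) $ u =
    (row (mat_of_cols n xs) u @\<^sub>v row (mat_of_cols n ys) u) \<bullet> (a @\<^sub>v b)"
    using u by simp
  also have "\<dots> = row (mat_of_cols n xs) u \<bullet> a + row (mat_of_cols n ys) u \<bullet> b"
    by (rule scalar_prod_append[OF _ _ a b]) (auto intro!: carrier_vecI)
  finally show "(mat_of_cols n (xs @ ys) *\<^sub>v (a @\<^sub>v b)) $ u =
    (mat_of_cols n xs *\<^sub>v a + mat_of_cols n ys *\<^sub>v b) $ u" using u by simp
qed simp

text \<open>A projector acts as the identity on its range, so for projectors with a common range both \<open>P * Q = Q\<close> and
\<open>Q * P = P\<close> hold; symmetry turns the second equation into \<open>P * Q = P\<close>.\<close>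

lemma orth_projector_unique:
  assumes "is_orth_projector X P" "is_orth_projector X Q"
  shows "P = Q"
proof -
  let ?n = "dim_row X"
  have *: "R * S = S" if R: "is_orth_projector X R" and S: "is_orth_projector X S" for R S
  proof (rule mat_eqI_mult_vec)
    have Rc: "R \<in> carrier_mat ?n ?n" and Sc: "S \<in> carrier_mat ?n ?n"
      using R S by (auto simp: is_orth_projector_def)
    then show "R * S \<in> carrier_mat ?n ?n" "S \<in> carrier_mat ?n ?n" by auto
    fix v :: "real vec" assume v: "v \<in> carrier_vec ?n"
    have "S *\<^sub>v v \<in> vec_space.col_space ?n S"
      using Sc v by (auto simp: vec_space.col_space_eq)
    also have "\<dots> = vec_space.col_space ?n R"
      using R S by (simp add: is_orth_projector_def)
    finally obtain z where z: "z \<in> carrier_vec ?n" "S *\<^sub>v v = R *\<^sub>v z"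
      using Rc by (auto simp: vec_space.col_space_eq)
    have "(R * S) *\<^sub>v v = (R * R) *\<^sub>v z"
      using Rc Sc v z by simp
    also have "R * R = R"
      using R by (simp add: is_orth_projector_def)
    finally show "(R * S) *\<^sub>v v = S *\<^sub>v v"
      using z by simp
  qed
  have Pc: "P \<in> carrier_mat ?n ?n" and Qc: "Q \<in> carrier_mat ?n ?n"
    and sym: "P\<^sup>T = P" "Q\<^sup>T = Q"
    using assms by (auto simp: is_orth_projector_def)
  have "P = (Q * P)\<^sup>T" using *[OF assms(2,1)] sym by simp
  also have "\<dots> = P * Q" using transpose_mult[OF Qc Pc] sym by simp
  also have "\<dots> = Q" using *[OF assms] .
  finally show ?thesis .
qed

text \<open>Gram-Schmidt in terms of projectors: if \<open>P\<close> projects onto the span of the earlier vectors and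
\<open>r = v - P v\<close>, then \<open>P + r r\<^sup>T / (r \<bullet> r)\<close> projects onto the span enlarged by \<open>v\<close>.
The list is extended at the front, and the range is described by combinations of the listed vectors, which spares
a choice of a basis. Idempotence follows from the last two clauses.\<close>

lemma projector_exists_list:
  assumes "set vs \<subseteq> carrier_vec n"
  shows "\<exists>P :: real mat. P \<in> carrier_mat n n \<and> P\<^sup>T = P \<and> (\<forall>v\<in>set vs. P *\<^sub>v v = v) \<and>
    (\<forall>w\<in>carrier_vec n. \<exists>z\<in>carrier_vec (length vs). P *\<^sub>v w = mat_of_cols n vs *\<^sub>v z)"
  using assms
proof (induction vs)
  case Nil
  have "0\<^sub>m n n *\<^sub>v w = mat_of_cols n [] *\<^sub>v 0\<^sub>v 0" if "w \<in> carrier_vec n" for w :: "real vec"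
    using that by (intro eq_vecI) (auto simp: scalar_prod_def)
  then show ?case
    by (intro exI[of _ "0\<^sub>m n n"]) (auto intro!: bexI[of _ "0\<^sub>v 0"])
next
  case (Cons v vs)
  then obtain P :: "real mat" where P: "P \<in> carrier_mat n n" "P\<^sup>T = P"
    and fix_vs: "\<And>u. u \<in> set vs \<Longrightarrow> P *\<^sub>v u = u"
    and ran: "\<And>w. w \<in> carrier_vec n \<Longrightarrow>
      \<exists>z\<in>carrier_vec (length vs). P *\<^sub>v w = mat_of_cols n vs *\<^sub>v z"
    by auto
  have v: "v \<in> carrier_vec n" and vs: "set vs \<subseteq> carrier_vec n" using Cons.prems by auto
  let ?X = "mat_of_cols n vs"
  have X: "?X \<in> carrier_mat n (length vs)" by simp
  have PX: "P *\<^sub>v (?X *\<^sub>v z) = ?X *\<^sub>v z" if z: "z \<in> carrier_vec (length vs)" for z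
  proof -
    have "P * ?X = ?X"
    proof (rule mat_col_eqI)
      fix i assume "i < dim_col ?X"
      then have i: "i < length vs" by simp
      then have "vs ! i \<in> carrier_vec n" using vs by auto
      then have "col (P * ?X) i = P *\<^sub>v (vs ! i)"
        using P X i by (subst col_mult2[OF P(1) X]) auto
      then show "col (P * ?X) i = col ?X i" 
        using i \<open>vs ! i \<in> carrier_vec n\<close> fix_vs[of "vs ! i"] by simp
    qed (use P in auto)
    then show ?thesis using P X z by (metis assoc_mult_mat_vec)
  qed
  have Pc[simp]: "P *\<^sub>v w \<in> carrier_vec n" if "w \<in> carrier_vec n" for w
    using P that by auto
  have PP: "P *\<^sub>v (P *\<^sub>v w) = P *\<^sub>v w" if w: "w \<in> carrier_vec n" for w
    using ran[OF w] PX by auto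
  have selfadj: "(P *\<^sub>v a) \<bullet> b = a \<bullet> (P *\<^sub>v b)" if "a \<in> carrier_vec n" "b \<in> carrier_vec n" for a b
    using transpose_vec_mult_scalar[OF P(1) that(2,1)] P(2) by simp
  define r where "r = v - P *\<^sub>v v"
  have r: "r \<in> carrier_vec n" using v by (auto simp: r_def)
  have Pr: "P *\<^sub>v r = 0\<^sub>v n"
    unfolding r_def using v P PP[OF v]
    by (subst mult_minus_distrib_mat_vec[OF P(1) v]) auto
  have v_eq: "v = P *\<^sub>v v + r"
    unfolding r_def using v P by (intro eq_vecI) auto
  have rP: "r \<bullet> (P *\<^sub>v w) = 0" if "w \<in> carrier_vec n" for w
    using selfadj[OF r that] Pr that by simp
  define c where "c = r \<bullet> r"
  \<comment> \<open>If \<open>v\<close> already lies in the span, then \<open>r = 0\<close> and \<open>c = 0\<close>, and the rank-one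
    correction vanishes by the convention \<open>x / 0 = 0\<close>.\<close>
  define P' where "P' = mat n n (\<lambda>(i,j). P $$ (i,j) + r $ i * r $ j / c)"
  have P': "P' \<in> carrier_mat n n" by (simp add: P'_def)
  have sym_entries: "P $$ (i,j) = P $$ (j,i)" if "i < n" "j < n" for i j
    using that P by (metis carrier_matD index_transpose_mat(1))
  have P'_mult: "P' *\<^sub>v w = P *\<^sub>v w + ((r \<bullet> w) / c) \<cdot>\<^sub>v r" if w: "w \<in> carrier_vec n" for w
  proof (rule eq_vecI)
    fix i assume "i < dim_vec (P *\<^sub>v w + ((r \<bullet> w) / c) \<cdot>\<^sub>v r)"
    then have i: "i < n" using r by simp
    have "(P' *\<^sub>v w) $ i = (\<Sum>j<n. (P $$ (i,j) + r $ i * r $ j / c) * w $ j)"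
      using i w by (auto simp: P'_def scalar_prod_def lessThan_atLeast0 intro!: sum.cong)
    also have "\<dots> = (\<Sum>j<n. P $$ (i,j) * w $ j) + (\<Sum>j<n. r $ j * w $ j) / c * r $ i"
      by (simp add: sum.distrib algebra_simps sum_distrib_left sum_divide_distrib)
    also have "\<dots> = (P *\<^sub>v w + ((r \<bullet> w) / c) \<cdot>\<^sub>v r) $ i"
      using i w r P by (auto simp: scalar_prod_def lessThan_atLeast0 intro!: sum.cong)
    finally show "(P' *\<^sub>v w) $ i = (P *\<^sub>v w + ((r \<bullet> w) / c) \<cdot>\<^sub>v r) $ i" .
  qed (use P P' r in auto)
  have "P'\<^sup>T = P'"
    by (rule eq_matI) (auto simp: P'_def sym_entries mult.commute)
  moreover have "P' *\<^sub>v u = u" if "u \<in> set (v # vs)" for u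
  proof (cases "u \<in> set vs")
    case True
    then have u: "u \<in> carrier_vec n" using vs by auto
    have "r \<bullet> u = 0" using rP[OF u] fix_vs[OF True] by simp
    then show ?thesis using P'_mult[OF u] fix_vs[OF True] u r by (auto intro!: eq_vecI)
  next
    case False
    then have u: "u = v" using that by simp
    have rv: "r \<bullet> v = c"
      using arg_cong[OF v_eq, of "\<lambda>x. r \<bullet> x"] rP[OF v] scalar_prod_add_distrib[OF r Pc[OF v] r]
      by (simp add: c_def)
    have "(c / c) \<cdot>\<^sub>v r = r"
    proof (cases "c = 0")
      case True
      then have "r = 0\<^sub>v n"
        using conjugate_square_eq_0_vec[OF r] by (simp add: c_def)
      then show ?thesis by (auto intro!: eq_vecI)
    qed (simp)
    then show ?thesis using P'_mult[OF v] rv v_eq u by simp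
  qed
  moreover have "\<exists>z\<in>carrier_vec (length (v # vs)). P' *\<^sub>v w = mat_of_cols n (v # vs) *\<^sub>v z"
    if w: "w \<in> carrier_vec n" for w
  proof -
    define d where "d = (r \<bullet> w) / c"
    have w': "w - d \<cdot>\<^sub>v v \<in> carrier_vec n" using w v by simp
    obtain z where z: "z \<in> carrier_vec (length vs)"
      and Pz: "P *\<^sub>v (w - d \<cdot>\<^sub>v v) = ?X *\<^sub>v z" using ran[OF w'] by auto
    let ?d = "vec 1 (\<lambda>_. d)"
    have one: "mat_of_cols n [v] *\<^sub>v ?d = d \<cdot>\<^sub>v v"
      using v by (intro eq_vecI) (auto simp: scalar_prod_def mat_of_cols_index)
    have "mat_of_cols n (v # vs) *\<^sub>v (?d @\<^sub>v z) = d \<cdot>\<^sub>v v + ?X *\<^sub>v z"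
      using mat_of_cols_append_mult_vec[of "[v]" n vs ?d z] v vs z one by simp
    also have "\<dots> = d \<cdot>\<^sub>v v + (P *\<^sub>v w - d \<cdot>\<^sub>v (P *\<^sub>v v))"
      unfolding Pz[symmetric] using w v P
      by (subst mult_minus_distrib_mat_vec[OF P(1) w]) (auto simp: mult_mat_vec)
    also have "\<dots> = P *\<^sub>v w + d \<cdot>\<^sub>v r"
      unfolding r_def using w v P by (intro eq_vecI) (auto simp: algebra_simps)
    finally have "P' *\<^sub>v w = mat_of_cols n (v # vs) *\<^sub>v (?d @\<^sub>v z)"
      unfolding P'_mult[OF w] d_def[symmetric] by (rule sym)
    moreover have "?d @\<^sub>v z \<in> carrier_vec (length (v # vs))"
      using carrier_vecD[OF z] by (intro carrier_vecI) simp
    ultimately show ?thesis by blast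
  qed
  ultimately show ?case using P' by blast
qed

lemma orth_projector_is_orth_projector: "is_orth_projector X (orth_projector X)"
proof -
  let ?n = "dim_row X"
  have cX: "set (cols X) \<subseteq> carrier_vec ?n" using cols_dim by blast
  obtain P :: "real mat" where P: "P \<in> carrier_mat ?n ?n" "P\<^sup>T = P"
    and fixc: "\<And>v. v \<in> set (cols X) \<Longrightarrow> P *\<^sub>v v = v"
    and ran: "\<And>w. w \<in> carrier_vec ?n \<Longrightarrow> \<exists>z\<in>carrier_vec (dim_col X). P *\<^sub>v w = X *\<^sub>v z"
    using projector_exists_list[OF cX] by (auto simp: mat_of_cols_cols)
  have PX: "P * X = X"
  proof (rule mat_col_eqI)
    fix i assume i: "i < dim_col X"
    then show "col (P * X) i = col X i"
      using P fixc[of "col X i"] by (subst col_mult2[of _ ?n ?n _ "dim_col X"]) (auto simp: cols_def)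
  qed (use P in auto)
  have PXz: "P *\<^sub>v (X *\<^sub>v z) = X *\<^sub>v z" if "z \<in> carrier_vec (dim_col X)" for z
    using that P PX by (metis assoc_mult_mat_vec carrier_mat_triv)
  have "P * P = P"
  proof (rule mat_eqI_mult_vec)
    fix v :: "real vec" assume v: "v \<in> carrier_vec ?n"
    then show "(P * P) *\<^sub>v v = P *\<^sub>v v"
      using P ran[OF v] PXz by auto
  qed (use P in auto)
  moreover have "vec_space.col_space ?n P = vec_space.col_space ?n X"
  proof -
    have "X \<in> carrier_mat ?n (dim_col X)" by simp
    note eqs = vec_space.col_space_eq[OF P(1)] vec_space.col_space_eq[OF this]
    show ?thesis
      unfolding eqs
    proof (intro subset_antisym subsetI)
      fix y assume "y \<in> {y \<in> carrier_vec (dim_row P). \<exists>x\<in>carrier_vec (dim_col P). P *\<^sub>v x = y}"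
      then obtain x where x: "x \<in> carrier_vec ?n" and y: "y = P *\<^sub>v x" using P by auto
      obtain z where "z \<in> carrier_vec (dim_col X)" "y = X *\<^sub>v z" using ran[OF x] y by auto
      then show "y \<in> {y \<in> carrier_vec ?n. \<exists>x\<in>carrier_vec (dim_col X). X *\<^sub>v x = y}"
        by (auto intro!: carrier_vecI)
    next
      fix y assume "y \<in> {y \<in> carrier_vec ?n. \<exists>x\<in>carrier_vec (dim_col X). X *\<^sub>v x = y}"
      then obtain z where "z \<in> carrier_vec (dim_col X)" "y = X *\<^sub>v z" and y: "y \<in> carrier_vec ?n"
        by auto
      then have "P *\<^sub>v y = y" using PXz by simp
      then show "y \<in> {y \<in> carrier_vec (dim_row P). \<exists>x\<in>carrier_vec (dim_col P). P *\<^sub>v x = y}"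
        using y P by auto
    qed
  qed
  ultimately have isP: "is_orth_projector X P" using P by (simp add: is_orth_projector_def)
  show ?thesis
    unfolding orth_projector_def by (rule theI[of "is_orth_projector X", OF isP]) (rule orth_projector_unique[OF _ isP])
qed

lemma orth_projector_fixes:
  assumes P: "is_orth_projector X P" and X: "X \<in> carrier_mat n k"
    and y: "y \<in> vec_space.col_space n X"
  shows "P *\<^sub>v y = y"
proof -
  have Pc: "P \<in> carrier_mat n n" and PP: "P * P = P"
    and "y \<in> vec_space.col_space n P"
    using P X y by (auto simp: is_orth_projector_def)
  then obtain z where z: "z \<in> carrier_vec n" "y = P *\<^sub>v z"
    by (auto simp: vec_space.col_space_eq)
  have "P *\<^sub>v y = (P * P) *\<^sub>v z" unfolding z(2) using Pc z(1) by simp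
  then show ?thesis using PP z by simp
qed

lemma orth_projector_range:
  assumes P: "is_orth_projector X P" and X: "X \<in> carrier_mat n k" and w: "w \<in> carrier_vec n"
  shows "P *\<^sub>v w \<in> vec_space.col_space n X"
proof -
  have "P \<in> carrier_mat n n" "vec_space.col_space n X = vec_space.col_space n P"
    using P X by (auto simp: is_orth_projector_def)
  then show ?thesis using w by (auto simp: vec_space.col_space_eq)
qed

lemma orth_projector_selfadjoint:
  assumes P: "is_orth_projector X P" and X: "X \<in> carrier_mat n k"
    and "v \<in> carrier_vec n" "w \<in> carrier_vec n"
  shows "(P *\<^sub>v v) \<bullet> w = v \<bullet> (P *\<^sub>v w)"
proof -
  have "P \<in> carrier_mat n n" "P\<^sup>T = P" using P X by (auto simp: is_orth_projector_def)
  then show ?thesis using transpose_vec_mult_scalar[of P n n w v] assms by simp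
qed

text \<open>Self-adjointness and idempotence give \<open>\<bar>P q\<bar>\<^sup>2 = q \<bullet> P q\<close>, and \<open>P q\<close> is in the column space.\<close>

lemma orth_projector_kills_orthogonal:
  assumes P: "is_orth_projector X P" and X: "X \<in> carrier_mat n k"
    and q: "q \<in> carrier_vec n" and orth: "\<And>y. y \<in> vec_space.col_space n X \<Longrightarrow> y \<bullet> q = 0"
  shows "P *\<^sub>v q = 0\<^sub>v n"
proof -
  have Pc: "P \<in> carrier_mat n n" using P X by (auto simp: is_orth_projector_def)
  then have Pq: "P *\<^sub>v q \<in> carrier_vec n" using q by simp
  have "(P *\<^sub>v q) \<bullet> (P *\<^sub>v q) = q \<bullet> (P *\<^sub>v (P *\<^sub>v q))"
    by (rule orth_projector_selfadjoint[OF P X q Pq])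
  also have "P *\<^sub>v (P *\<^sub>v q) = P *\<^sub>v q"
    by (rule orth_projector_fixes[OF P X orth_projector_range[OF P X q]])
  also have "q \<bullet> (P *\<^sub>v q) = (P *\<^sub>v q) \<bullet> q"
    by (rule comm_scalar_prod[OF q Pq])
  also have "\<dots> = 0"
    by (rule orth[OF orth_projector_range[OF P X q]])
  finally show ?thesis using conjugate_square_eq_0_vec[OF Pq] by simp
qed

text \<open>\<open>q\<close> is the residual of \<open>b\<close> modulo the column space, so \<open>I - P\<close> turns \<open>b\<close> into
\<open>q\<close>, and \<open>a\<close> differs from \<open>p\<close> by a vector orthogonal to \<open>q\<close>.\<close>

lemma projected_scalar_prod:
  assumes P: "is_orth_projector X P" and X: "X \<in> carrier_mat n k"
    and carr: "a \<in> carrier_vec n" "b \<in> carrier_vec n" "p \<in> carrier_vec n" "q \<in> carrier_vec n"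
    and sp: "a - p \<in> vec_space.col_space n X" "b - q \<in> vec_space.col_space n X"
    and orth: "\<And>y. y \<in> vec_space.col_space n X \<Longrightarrow> y \<bullet> q = 0"
  shows "a \<bullet> ((1\<^sub>m n - P) *\<^sub>v b) = p \<bullet> q"
proof -
  have Pc: "P \<in> carrier_mat n n" using P X by (auto simp: is_orth_projector_def)
  have b: "b = (b - q) + q" and a: "a = (a - p) + p" using carr by auto
  have "P *\<^sub>v b = P *\<^sub>v (b - q) + P *\<^sub>v q"
    using Pc carr by (subst b, subst mult_add_distrib_mat_vec[OF Pc]) auto
  also have "\<dots> = b - q"
    using orth_projector_fixes[OF P X sp(2)] orth_projector_kills_orthogonal[OF P X carr(4) orth] carr
    by auto
  finally have "(1\<^sub>m n - P) *\<^sub>v b = q"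
    using carr Pc by (subst minus_mult_distrib_mat_vec[of _ n n]) auto
  moreover have "a \<bullet> q = (a - p) \<bullet> q + p \<bullet> q"
    using carr by (subst a, subst add_scalar_prod_distrib[of _ n]) auto
  ultimately show ?thesis using orth[OF sp(1)] by simp
qed

text \<open>The quadratic form of \<open>I - P\<close> at \<open>y\<close> is the squared length of \<open>y - P y\<close>.\<close>

lemma projected_norm_zero:
  assumes P: "is_orth_projector X P" and X: "X \<in> carrier_mat n k" and y: "y \<in> carrier_vec n"
    and zero: "y \<bullet> ((1\<^sub>m n - P) *\<^sub>v y) = 0"
  shows "y \<in> vec_space.col_space n X"
proof -
  have Pc: "P \<in> carrier_mat n n" using P X by (auto simp: is_orth_projector_def)
  then have Py: "P *\<^sub>v y \<in> carrier_vec n" using y by simp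
  let ?r = "y - P *\<^sub>v y"
  have r: "?r \<in> carrier_vec n" using y Py by simp
  have e: "(1\<^sub>m n - P) *\<^sub>v y = ?r"
    using y Pc by (subst minus_mult_distrib_mat_vec[of _ n n]) auto
  have "P *\<^sub>v (P *\<^sub>v y) = P *\<^sub>v y"
    by (rule orth_projector_fixes[OF P X orth_projector_range[OF P X y]])
  then have "P *\<^sub>v ?r = 0\<^sub>v n"
    using Py by (subst mult_minus_distrib_mat_vec[OF Pc y Py]) auto
  then have "(P *\<^sub>v y) \<bullet> ?r = 0"
    using orth_projector_selfadjoint[OF P X y r] y by simp
  moreover have "?r \<bullet> ?r = y \<bullet> ?r - (P *\<^sub>v y) \<bullet> ?r"
    by (rule minus_scalar_prod_distrib[OF y Py r])
  ultimately have "?r \<bullet> ?r = 0" using zero e by simp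
  then have "?r = 0\<^sub>v n" using conjugate_square_eq_0_vec[OF r] by simp
  have "y = P *\<^sub>v y"
  proof (rule eq_vecI)
    fix i assume "i < dim_vec (P *\<^sub>v y)"
    then have "i < n" using Pc by simp
    then show "y $ i = (P *\<^sub>v y) $ i"
      using arg_cong[OF \<open>?r = 0\<^sub>v n\<close>, of "\<lambda>v. v $ i"] y Pc by simp
  qed (use y Pc in auto)
  then show ?thesis using orth_projector_range[OF P X y] by simp
qed

text \<open>The kernel is the line of constant vectors. It is nonzero, so the rank is less than \<open>n\<close>. The first
\<open>n - 1\<close> columns are independent, since a relation between them is a kernel vector with last entry \<open>0\<close>.\<close>

lemma rank_if_kernel_constants:
  fixes Q :: "real mat"
  assumes Q: "Q \<in> carrier_mat n n" and n: "0 < n"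
    and ones: "Q *\<^sub>v vec n (\<lambda>_. 1) = 0\<^sub>v n"
    and const: "\<And>w i. w \<in> carrier_vec n \<Longrightarrow> Q *\<^sub>v w = 0\<^sub>v n \<Longrightarrow> i < n \<Longrightarrow> w $ i = w $ (n - 1)"
  shows "vec_space.rank n Q = n - 1"
proof -
  define cs where "cs = take (n - 1) (cols Q)"
  define A where "A = mat_of_cols n cs"
  have len: "length cs = n - 1" using Q by (simp add: cs_def)
  have cs: "set cs \<subseteq> set (cols Q)" by (auto simp: cs_def dest: in_set_takeD)
  have csc: "set cs \<subseteq> carrier_vec n" using cs Q cols_dim by blast
  have A: "A \<in> carrier_mat n (n - 1)" using len mat_of_cols_carrier(1)[of n cs] by (simp add: A_def)
  have colsA: "cols A = cs" using csc by (simp add: A_def)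
  have A0: "v = 0\<^sub>v (n - 1)" if v: "v \<in> carrier_vec (n - 1)" and "A *\<^sub>v v = 0\<^sub>v n" for v
  proof -
    let ?w = "v @\<^sub>v 0\<^sub>v 1"
    have w: "?w \<in> carrier_vec n" using v n by (intro carrier_vecI) simp
    have dr: "length (drop (n - 1) (cols Q)) = 1" using Q n by simp
    have "Q = mat_of_cols n (cs @ drop (n - 1) (cols Q))"
      unfolding cs_def append_take_drop_id using Q mat_of_cols_cols[of Q] by (metis carrier_matD(1))
    also have "\<dots> *\<^sub>v ?w = A *\<^sub>v v + mat_of_cols n (drop (n - 1) (cols Q)) *\<^sub>v 0\<^sub>v 1"
      unfolding A_def using csc v len dr Q cols_dim[of Q]
      by (intro mat_of_cols_append_mult_vec) (auto dest: in_set_dropD)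
    also have "\<dots> = 0\<^sub>v n"
      using that dr by (intro eq_vecI) (auto simp: scalar_prod_def)
    finally have Q0: "Q *\<^sub>v ?w = 0\<^sub>v n" .
    show ?thesis
    proof (rule eq_vecI)
      fix i assume "i < dim_vec (0\<^sub>v (n - 1))"
      then have i: "i < n - 1" by simp
      then have "?w $ i = ?w $ (n - 1)" using const[OF w Q0, of i] by simp
      then show "v $ i = 0\<^sub>v (n - 1) $ i" using i v by simp
    qed (use v in simp)
  qed
  have dist: "distinct cs"
  proof (rule ccontr)
    assume "\<not> distinct cs"
    then obtain i j where ij: "i < n - 1" "j < n - 1" "i \<noteq> j" "cs ! i = cs ! j"
      using len by (auto simp: distinct_conv_nth)
    let ?v = "unit_vec (n - 1) i - unit_vec (n - 1) j :: real vec"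
    have "A *\<^sub>v ?v = col A i - col A j"
      using A ij by (subst mult_minus_distrib_mat_vec[OF A]) (auto intro!: eq_vecI)
    also have "\<dots> = 0\<^sub>v n"
    proof -
      have "cs ! i \<in> carrier_vec n" using ij csc len by auto
      then show ?thesis using ij len by (simp add: A_def)
    qed
    finally have "?v = 0\<^sub>v (n - 1)" by (intro A0) auto
    then have "?v $ i = 0" using ij by simp
    then show False using ij by simp
  qed
  interpret vec_space "TYPE(real)" n .
  have "lin_indpt (set cs)"
  proof (rule ccontr)
    assume "\<not> lin_indpt (set cs)"
    then show False
      using lin_depE[OF A] colsA dist A0 by metis
  qed
  then have "n - 1 \<le> rank Q"
    using rank_ge_card_indpt[OF Q cs] dist len by (simp add: distinct_card)
  moreover have "det Q = 0"
  proof -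
    have "vec n (\<lambda>_. 1 :: real) \<noteq> 0\<^sub>v n"
      using n by (auto dest: arg_cong[of _ _ "\<lambda>w. w $ 0"])
    then show ?thesis
      using ones by (subst det_0_iff_vec_prod_zero_field[OF Q]) (auto intro!: exI[of _ "vec n (\<lambda>_. 1)"])
  qed
  then have "rank Q < n" by (rule det_zero_low_rank[OF Q])
  ultimately show ?thesis by simp
qed

section \<open>Factor spaces as functions on the runs\<close>

text \<open>This is the column space of \<open>X\<^sub>T\<close>, with a vector seen as a function of the run.\<close>

definition additive_in :: "plan \<Rightarrow> factor set \<Rightarrow> (nat \<Rightarrow> real) \<Rightarrow> bool" where
  "additive_in D T f \<longleftrightarrow> (\<exists>g. \<forall>u<length D. f u = (\<Sum>B\<in>T. g B (level_of D u B)))"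

lemma design_mat_carrier: "design_mat s D A \<in> carrier_mat (length D) (levels s A)"
  by (simp add: design_mat_def)

lemma design_mat_mult_vec:
  assumes "u < length D" "level_of D u A < levels s A" "a \<in> carrier_vec (levels s A)"
  shows "(design_mat s D A *\<^sub>v a) $ u = a $ level_of D u A"
proof -
  have "(design_mat s D A *\<^sub>v a) $ u = (\<Sum>t<levels s A. (if level_of D u A = t then 1 else 0) * a $ t)"
    using assms by (auto simp: design_mat_def scalar_prod_def lessThan_atLeast0 intro!: sum.cong)
  also have "\<dots> = (\<Sum>t<levels s A. if level_of D u A = t then a $ t else 0)"
    by (rule sum.cong) auto
  also have "\<dots> = a $ level_of D u A"
    using assms(2) by simp
  finally show ?thesis .
qed

text \<open>A coefficient vector of the stacked matrix splits into one block for each factor, and the block of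
\<open>B\<close> is the function \<open>g B\<close> of its levels.\<close>

lemma range_of_stacked_design_mats:
  assumes "distinct Bs"
    and lev: "\<And>u B. u < length D \<Longrightarrow> B \<in> set Bs \<Longrightarrow> level_of D u B < levels s B"
    and y: "y \<in> carrier_vec (length D)"
  defines "X \<equiv> \<lambda>Bs. concat (map (\<lambda>B. cols (design_mat s D B)) Bs)"
  shows "(\<exists>z\<in>carrier_vec (length (X Bs)). mat_of_cols (length D) (X Bs) *\<^sub>v z = y) \<longleftrightarrow>
    additive_in D (set Bs) (\<lambda>u. y $ u)"
  using assms(1-3)
proof (induction Bs arbitrary: y)
  case Nil
  have "mat_of_cols (length D) [] *\<^sub>v z = 0\<^sub>v (length D)" if "z \<in> carrier_vec 0" for z :: "real vec"
    using that by (intro eq_vecI) (auto simp: scalar_prod_def)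
  moreover have "\<exists>z :: real vec. z \<in> carrier_vec 0" using zero_carrier_vec by blast
  ultimately have "(\<exists>z\<in>carrier_vec (length (X [])). mat_of_cols (length D) (X []) *\<^sub>v z = y) \<longleftrightarrow>
      y = 0\<^sub>v (length D)"
    by (auto simp: X_def)
  also have "\<dots> \<longleftrightarrow> additive_in D (set []) (\<lambda>u. y $ u)"
    using Nil.prems(3) by (auto simp: additive_in_def)
  finally show ?case .
next
  case (Cons B Bs)
  let ?n = "length D" and ?M = "design_mat s D B"
  have M: "?M \<in> carrier_mat ?n (levels s B)" by (rule design_mat_carrier)
  have XCons: "X (B # Bs) = cols ?M @ X Bs" by (simp add: X_def)
  have lenM: "length (cols ?M) = levels s B" using M by simp
  have colsM: "set (cols ?M) \<subseteq> carrier_vec ?n" using M cols_dim[of ?M] by simp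
  have XBs: "set (X Bs) \<subseteq> carrier_vec ?n"
  proof -
    have "set (cols (design_mat s D C)) \<subseteq> carrier_vec ?n" for C
      using design_mat_carrier[of s D C] cols_dim[of "design_mat s D C"] by simp
    then show ?thesis by (auto simp: X_def)
  qed
  have MM: "mat_of_cols ?n (cols ?M) = ?M" using M mat_of_cols_cols[of ?M] by simp
  have mult: "mat_of_cols ?n (X (B # Bs)) *\<^sub>v (a @\<^sub>v b) = ?M *\<^sub>v a + mat_of_cols ?n (X Bs) *\<^sub>v b"
    if "a \<in> carrier_vec (levels s B)" "b \<in> carrier_vec (length (X Bs))" for a b
    using mat_of_cols_append_mult_vec[OF colsM XBs, of a b] that lenM MM by (simp add: XCons)
  have levB: "level_of D u B < levels s B" if "u < ?n" for u
    using Cons.prems(2)[OF that] by simp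
  have B: "B \<notin> set Bs" and dist: "distinct Bs" using Cons.prems(1) by auto
  note IH = Cons.IH[OF dist Cons.prems(2)]
  show ?case
  proof
    assume "\<exists>z\<in>carrier_vec (length (X (B # Bs))). mat_of_cols ?n (X (B # Bs)) *\<^sub>v z = y"
    then obtain z where z: "z \<in> carrier_vec (levels s B + length (X Bs))"
      and zy: "mat_of_cols ?n (X (B # Bs)) *\<^sub>v z = y"
      using XCons lenM by auto
    define a b where "a = vec_first z (levels s B)" and "b = vec_last z (length (X Bs))"
    have ab: "a \<in> carrier_vec (levels s B)" "b \<in> carrier_vec (length (X Bs))"
      by (auto simp: a_def b_def)
    have "z = a @\<^sub>v b" using z by (simp add: a_def b_def)
    then have y_eq: "y = ?M *\<^sub>v a + mat_of_cols ?n (X Bs) *\<^sub>v b" using mult[OF ab] zy by simp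
    have "additive_in D (set Bs) (\<lambda>u. (mat_of_cols ?n (X Bs) *\<^sub>v b) $ u)"
      using IH[of "mat_of_cols ?n (X Bs) *\<^sub>v b"] ab(2)
        mult_mat_vec_carrier[OF mat_of_cols_carrier(1)[of ?n "X Bs"] ab(2)] by auto
    then obtain g where g: "\<And>u. u < ?n \<Longrightarrow>
        (mat_of_cols ?n (X Bs) *\<^sub>v b) $ u = (\<Sum>C\<in>set Bs. g C (level_of D u C))"
      by (auto simp: additive_in_def)
    have "y $ u = (\<Sum>C\<in>set (B # Bs). (g(B := \<lambda>t. a $ t)) C (level_of D u C))" if u: "u < ?n" for u
    proof -
      have "(\<Sum>C\<in>set Bs. (g(B := \<lambda>t. a $ t)) C (level_of D u C)) = (\<Sum>C\<in>set Bs. g C (level_of D u C))"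
        using B by (intro sum.cong) auto
      then show ?thesis
        using B u g[OF u] design_mat_mult_vec[OF u levB[OF u] ab(1)] M by (simp add: y_eq)
    qed
    then show "additive_in D (set (B # Bs)) (\<lambda>u. y $ u)" unfolding additive_in_def by blast
  next
    assume "additive_in D (set (B # Bs)) (\<lambda>u. y $ u)"
    then obtain g where g: "\<And>u. u < ?n \<Longrightarrow> y $ u = (\<Sum>C\<in>set (B # Bs). g C (level_of D u C))"
      by (auto simp: additive_in_def)
    define y' where "y' = vec ?n (\<lambda>u. \<Sum>C\<in>set Bs. g C (level_of D u C))"
    have "additive_in D (set Bs) (\<lambda>u. y' $ u)" by (auto simp: additive_in_def y'_def)
    then obtain b where b: "b \<in> carrier_vec (length (X Bs))" "mat_of_cols ?n (X Bs) *\<^sub>v b = y'"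
      using IH[of y'] by (auto simp: y'_def)
    define a where "a = vec (levels s B) (g B)"
    have a: "a \<in> carrier_vec (levels s B)" by (simp add: a_def)
    have "?M *\<^sub>v a + y' = y"
    proof (rule eq_vecI)
      fix u assume "u < dim_vec y"
      then have u: "u < ?n" using Cons.prems(3) by simp
      then show "(?M *\<^sub>v a + y') $ u = y $ u"
        using design_mat_mult_vec[OF u levB[OF u] a] g[OF u] levB[OF u] M B
        by (simp add: y'_def a_def)
    qed (use Cons.prems(3) M in \<open>auto simp: y'_def\<close>)
    then have "mat_of_cols ?n (X (B # Bs)) *\<^sub>v (a @\<^sub>v b) = y" using mult[OF a b(1)] b(2) by simp
    moreover have "a @\<^sub>v b \<in> carrier_vec (length (X (B # Bs)))"
      using carrier_vecD[OF a] carrier_vecD[OF b(1)] lenM by (intro carrier_vecI) (simp add: XCons)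
    ultimately show "\<exists>z\<in>carrier_vec (length (X (B # Bs))). mat_of_cols ?n (X (B # Bs)) *\<^sub>v z = y"
      by blast
  qed
qed

lemma design_mat_set_carrier:
  "\<exists>k. design_mat_set s D T \<in> carrier_mat (length D) k"
  by (auto simp: design_mat_set_def intro: mat_of_cols_carrier(1))

lemma col_space_design_mat_set:
  assumes "finite T" and "\<And>u B. u < length D \<Longrightarrow> B \<in> T \<Longrightarrow> level_of D u B < levels s B"
  shows "y \<in> vec_space.col_space (length D) (design_mat_set s D T) \<longleftrightarrow>
    y \<in> carrier_vec (length D) \<and> additive_in D T (\<lambda>u. y $ u)"
proof -
  let ?cs = "concat (map (\<lambda>B. cols (design_mat s D B)) (sorted_list_of_set T))"
  have "design_mat_set s D T \<in> carrier_mat (length D) (length ?cs)"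
    unfolding design_mat_set_def by (rule mat_of_cols_carrier)
  then have "y \<in> vec_space.col_space (length D) (design_mat_set s D T) \<longleftrightarrow>
    y \<in> carrier_vec (length D) \<and>
    (\<exists>z\<in>carrier_vec (length ?cs). mat_of_cols (length D) ?cs *\<^sub>v z = y)"
    by (subst vec_space.col_space_eq) (auto simp: design_mat_set_def)
  also have "\<dots> \<longleftrightarrow> y \<in> carrier_vec (length D) \<and> additive_in D T (\<lambda>u. y $ u)"
    using range_of_stacked_design_mats[of "sorted_list_of_set T" D s y] assms by auto
  finally show ?thesis .
qed

lemma level_of_less_levels:
  assumes "is_plan s m D" "A \<in> all_factors m" "u < length D"
  shows "level_of D u A < levels s A"
proof (cases A)
  case (Some i)
  then have "i < m" using assms(2) by (auto simp: all_factors_def treatment_factors_def)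
  moreover have "D ! u \<in> set D" using assms(3) by simp
  ultimately show ?thesis using assms(1) Some by (auto simp: is_plan_def)
qed simp

lemma finite_all_factors: "finite (all_factors m)"
  by (simp add: all_factors_def treatment_factors_def)

text \<open>\<open>q t'\<close> is the residual modulo \<open>T\<close> of the indicator function of the level \<open>t'\<close> of
\<open>B\<close>, and \<open>p t\<close> agrees modulo \<open>T\<close> with that of the level \<open>t\<close> of \<open>A\<close>. So
their scalar products are the entries of \<open>X\<^sub>A' (I - P\<^sub>T) X\<^sub>B\<close>.\<close>

lemma orthogonal_throughI:
  assumes D: "is_plan s m D" and T: "T \<subseteq> all_factors m"
    and AB: "A \<in> all_factors m" "B \<in> all_factors m"
    and p: "\<And>t. t < levels s A \<Longrightarrow>
      additive_in D T (\<lambda>u. (if level_of D u A = t then 1 else 0) - p t u)"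
    and q: "\<And>t. t < levels s B \<Longrightarrow>
      additive_in D T (\<lambda>u. (if level_of D u B = t then 1 else 0) - q t u)"
    and q_orth: "\<And>t C g. t < levels s B \<Longrightarrow> C \<in> T \<Longrightarrow> 
      (\<Sum>u<length D. g (level_of D u C) * q t u) = 0"
    and pq: "\<And>t t'. t < levels s A \<Longrightarrow> t' < levels s B \<Longrightarrow> (\<Sum>u<length D. p t u * q t' u) = 0"
  shows "orthogonal_through s D T A B"
proof -
  let ?n = "length D" and ?X = "design_mat_set s D T" and ?P = "proj s D T"
  obtain k where X: "?X \<in> carrier_mat ?n k" using design_mat_set_carrier by blast
  have P: "is_orth_projector ?X ?P"
    unfolding proj_def by (rule orth_projector_is_orth_projector)
  then have Pc: "?P \<in> carrier_mat ?n ?n" using X by (auto simp: is_orth_projector_def)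
  have finT: "finite T" using T finite_all_factors finite_subset by blast
  have cs: "y \<in> vec_space.col_space ?n ?X \<longleftrightarrow> y \<in> carrier_vec ?n \<and> additive_in D T (\<lambda>u. y $ u)" for y
    using col_space_design_mat_set[OF finT, of D s y] level_of_less_levels[OF D] T by blast
  let ?A = "design_mat s D A" and ?B = "design_mat s D B"
  have A: "?A \<in> carrier_mat ?n (levels s A)" and B: "?B \<in> carrier_mat ?n (levels s B)"
    by (rule design_mat_carrier)+
  have E: "1\<^sub>m ?n - ?P \<in> carrier_mat ?n ?n" using Pc by (rule minus_carrier_mat)
  have entry: "col ?A t \<bullet> ((1\<^sub>m ?n - ?P) *\<^sub>v col ?B t') = 0"
    if t: "t < levels s A" and t': "t' < levels s B" for t t'
  proof -
    let ?p = "vec ?n (p t)" and ?q = "vec ?n (q t')"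
    have "col ?A t \<bullet> ((1\<^sub>m ?n - ?P) *\<^sub>v col ?B t') = ?p \<bullet> ?q"
    proof (rule projected_scalar_prod[OF P X])
      show "col ?A t - ?p \<in> vec_space.col_space ?n ?X"
        unfolding cs using p[OF t] t by (auto simp: additive_in_def design_mat_def)
      show "col ?B t' - ?q \<in> vec_space.col_space ?n ?X"
        unfolding cs using q[OF t'] t' by (auto simp: additive_in_def design_mat_def)
    next
      fix y assume "y \<in> vec_space.col_space ?n ?X"
      then obtain g where y: "y \<in> carrier_vec ?n"
        and g: "\<And>u. u < ?n \<Longrightarrow> y $ u = (\<Sum>C\<in>T. g C (level_of D u C))"
        unfolding cs additive_in_def by blast
      have "y \<bullet> ?q = (\<Sum>u<?n. (\<Sum>C\<in>T. g C (level_of D u C)) * q t' u)"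
        using y g by (auto simp: scalar_prod_def lessThan_atLeast0 intro!: sum.cong)
      also have "\<dots> = (\<Sum>C\<in>T. \<Sum>u<?n. g C (level_of D u C) * q t' u)"
        unfolding sum_distrib_right by (rule sum.swap)
      also have "\<dots> = 0" using q_orth[OF t'] by simp
      finally show "y \<bullet> ?q = 0" .
    qed (use A B in \<open>auto intro!: carrier_vecI\<close>)
    also have "\<dots> = (\<Sum>u<?n. p t u * q t' u)"
      by (auto simp: scalar_prod_def lessThan_atLeast0 intro!: sum.cong)
    finally show ?thesis using pq[OF t t'] by simp
  qed
  show ?thesis
    unfolding orthogonal_through_def
  proof (rule eq_matI)
    fix t t' assume "t < dim_row (0\<^sub>m (levels s A) (levels s B))" "t' < dim_col (0\<^sub>m (levels s A) (levels s B))"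
    then have t: "t < levels s A" and t': "t' < levels s B" by auto
    have "?A\<^sup>T * (1\<^sub>m ?n - ?P) * ?B = ?A\<^sup>T * ((1\<^sub>m ?n - ?P) * ?B)"
      using A B E by (intro assoc_mult_mat) auto
    also have "\<dots> $$ (t, t') = col ?A t \<bullet> col ((1\<^sub>m ?n - ?P) * ?B) t'"
      using A B E t t' by simp
    also have "col ((1\<^sub>m ?n - ?P) * ?B) t' = (1\<^sub>m ?n - ?P) *\<^sub>v col ?B t'"
      by (rule col_mult2[OF E B t'])
    finally show "(?A\<^sup>T * (1\<^sub>m ?n - ?P) * ?B) $$ (t, t') = 0\<^sub>m (levels s A) (levels s B) $$ (t, t')"
      using entry[OF t t'] t t' by simp
  qed (use A B in auto)
qed

text \<open>The kernel of \<open>C\<^sub>A\<close> consists of the functions of the level of \<open>A\<close> that belong to the span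
of the other factors. It always contains the constants, since these belong to every factor space. So the rank
is as required once no other function does.\<close>

lemma connected_planI:
  assumes D: "is_plan s m D" and m: "0 < m" and s: "0 < s"
    and indep: "\<And>A w t. A \<in> all_factors m \<Longrightarrow>
      additive_in D (all_factors m - {A}) (\<lambda>u. w (level_of D u A)) \<Longrightarrow> t < levels s A \<Longrightarrow>
      w t = w (levels s A - 1)"
  shows "connected_plan s m D"
  unfolding connected_plan_def
proof
  fix A assume A: "A \<in> all_factors m"
  let ?n = "length D" and ?T = "all_factors m - {A}"
  let ?X = "design_mat_set s D ?T" and ?P = "proj s D ?T" and ?A = "design_mat s D A"
  let ?l = "levels s A" and ?C = "C_mat s m D A"
  obtain k where X: "?X \<in> carrier_mat ?n k" using design_mat_set_carrier by blast
  have P: "is_orth_projector ?X ?P"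
    unfolding proj_def by (rule orth_projector_is_orth_projector)
  then have Pc: "?P \<in> carrier_mat ?n ?n" using X by (auto simp: is_orth_projector_def)
  have finT: "finite ?T" using finite_all_factors by blast
  have cs: "y \<in> vec_space.col_space ?n ?X \<longleftrightarrow> y \<in> carrier_vec ?n \<and> additive_in D ?T (\<lambda>u. y $ u)" for y
    using col_space_design_mat_set[OF finT, of D s y] level_of_less_levels[OF D] by blast
  have Ac: "?A \<in> carrier_mat ?n ?l" by (rule design_mat_carrier)
  have E: "1\<^sub>m ?n - ?P \<in> carrier_mat ?n ?n" using Pc by (rule minus_carrier_mat)
  have Cc: "?C \<in> carrier_mat ?l ?l" using Ac E by (simp add: C_mat_def)
  have l: "0 < ?l" using s by (cases A) auto
  have Cw: "?C *\<^sub>v w = ?A\<^sup>T *\<^sub>v ((1\<^sub>m ?n - ?P) *\<^sub>v (?A *\<^sub>v w))" if "w \<in> carrier_vec ?l" for w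
  proof -
    have "?A\<^sup>T * (1\<^sub>m ?n - ?P) * ?A = ?A\<^sup>T * ((1\<^sub>m ?n - ?P) * ?A)"
      using Ac E by (intro assoc_mult_mat) auto
    then have "?C *\<^sub>v w = ?A\<^sup>T *\<^sub>v (((1\<^sub>m ?n - ?P) * ?A) *\<^sub>v w)"
      unfolding C_mat_def using Ac E that
      by (metis assoc_mult_mat_vec mult_carrier_mat transpose_carrier_mat)
    then show ?thesis using assoc_mult_mat_vec[OF E Ac that] by simp
  qed
  have Aw: "(?A *\<^sub>v w) $ u = w $ level_of D u A" if "w \<in> carrier_vec ?l" "u < ?n" for w u
    using design_mat_mult_vec[OF that(2) level_of_less_levels[OF D A that(2)] that(1)] .
  show "vec_space.rank ?l ?C = ?l - 1"
  proof (rule rank_if_kernel_constants[OF Cc l])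
    let ?o = "vec ?l (\<lambda>_. 1)" and ?y = "vec ?n (\<lambda>_. 1 :: real)"
    have y: "?A *\<^sub>v ?o = ?y"
    proof (rule eq_vecI)
      fix u assume "u < dim_vec ?y"
      then show "(?A *\<^sub>v ?o) $ u = ?y $ u"
        using Aw[of ?o u] level_of_less_levels[OF D A, of u] by simp
    qed (use Ac in simp)
    obtain B where B: "B \<in> ?T"
    proof (cases A)
      case None
      then have "Some 0 \<in> ?T" using m by (auto simp: all_factors_def treatment_factors_def)
      then show ?thesis by (rule that)
    next
      case (Some i)
      then have "None \<in> ?T" by (auto simp: all_factors_def)
      then show ?thesis by (rule that)
    qed
    have "(\<Sum>C\<in>?T. (if C = B then 1 else 0 :: real)) = 1" using B finT by simp
    then have "additive_in D ?T (\<lambda>u. ?y $ u)"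
      unfolding additive_in_def by (intro exI[of _ "\<lambda>C _. if C = B then 1 else 0"]) simp
    then have "?y \<in> vec_space.col_space ?n ?X" unfolding cs by simp
    then have "?P *\<^sub>v ?y = ?y" by (rule orth_projector_fixes[OF P X])
    then have "(1\<^sub>m ?n - ?P) *\<^sub>v ?y = 0\<^sub>v ?n"
      using Pc by (subst minus_mult_distrib_mat_vec[of _ ?n ?n]) auto
    then show "?C *\<^sub>v ?o = 0\<^sub>v ?l"
      using Cw[of ?o] y Ac by (auto intro!: eq_vecI)
  next
    fix w t assume w: "w \<in> carrier_vec ?l" and 0: "?C *\<^sub>v w = 0\<^sub>v ?l" and t: "t < ?l"
    let ?y = "?A *\<^sub>v w"
    have y: "?y \<in> carrier_vec ?n" using Ac w by simp
    have Ey: "(1\<^sub>m ?n - ?P) *\<^sub>v ?y \<in> carrier_vec ?n" using E y by simp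
    have "?y \<bullet> ((1\<^sub>m ?n - ?P) *\<^sub>v ?y) = ((1\<^sub>m ?n - ?P) *\<^sub>v ?y) \<bullet> ?y"
      by (rule comm_scalar_prod[OF y Ey])
    also have "\<dots> = (?A\<^sup>T *\<^sub>v ((1\<^sub>m ?n - ?P) *\<^sub>v ?y)) \<bullet> w"
      by (rule transpose_vec_mult_scalar[OF Ac w Ey, symmetric])
    also have "\<dots> = 0" unfolding Cw[OF w, symmetric] 0 using w by simp
    finally have "?y \<in> vec_space.col_space ?n ?X" by (rule projected_norm_zero[OF P X y])
    then have "additive_in D ?T (\<lambda>u. ?y $ u)" unfolding cs by simp
    then have "additive_in D ?T (\<lambda>u. w $ level_of D u A)"
      using Aw[OF w] by (simp add: additive_in_def)
    then show "w $ t = w $ (?l - 1)" using indep[OF A _ t, of "\<lambda>t. w $ t"] by simp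
  qed
qed

section \<open>The plan built from a Hadamard matrix\<close>

text \<open>\<open>e\<close> is a Hadamard matrix with constant first row, and \<open>L\<close> lists the runs \<open>(k, x, y)\<close> in
an arbitrary order.\<close>

locale swap_plan =
  fixes h s :: nat and e :: "nat \<Rightarrow> nat \<Rightarrow> real" and L :: "(nat \<times> nat \<times> nat) list"
  assumes h: "0 < h" and s: "3 \<le> s"
    and e_sign: "\<And>i k. i < h \<Longrightarrow> k < h \<Longrightarrow> e i k = 1 \<or> e i k = -1"
    and e_0: "\<And>k. k < h \<Longrightarrow> e 0 k = 1"
    and e_orth: "\<And>i i'. i < h \<Longrightarrow> i' < h \<Longrightarrow> (\<Sum>k<h. e i k * e i' k) = (if i = i' then real h else 0)"
    and distinct_L: "distinct L"
    and set_L: "set L = {..<h} \<times> {(x,y). x < s \<and> y < s \<and> x \<noteq> y}"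
begin

text \<open>Multiplying the sign of a factor by \<open>flip\<close> makes the factor \<open>1\<close> the opposite of the factor
\<open>0\<close>, and makes the two factors of every other row differ by a function that is antisymmetric in
\<open>x\<close> and \<open>y\<close>.\<close>

definition flip :: "nat \<Rightarrow> nat \<Rightarrow> nat \<Rightarrow> real" where
  "flip j x y = (if j = 1 \<or> (odd j \<and> y < x) then -1 else 1)"

definition choice_sign :: "nat \<Rightarrow> nat \<Rightarrow> nat \<Rightarrow> nat \<Rightarrow> real" where
  "choice_sign j k x y = e (j div 2) k * flip j x y"

definition level :: "nat \<Rightarrow> nat \<Rightarrow> nat \<Rightarrow> nat \<Rightarrow> nat" where
  "level j k x y = (if choice_sign j k x y = 1 then x else y)"

definition D :: plan where
  "D = map (\<lambda>(k,x,y). map (\<lambda>j. level j k x y) [0..<2 * h]) L"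

abbreviation pairs :: "(nat \<times> nat) set" where
  "pairs \<equiv> {(x,y). x < s \<and> y < s \<and> x \<noteq> y}"

lemma finite_pairs: "finite pairs"
  by (rule finite_subset[of _ "{..<s} \<times> {..<s}"]) auto

lemma length_D: "length D = length L"
  by (simp add: D_def)

lemma level_of_D: "u < length L \<Longrightarrow> L ! u = (k,x,y) \<Longrightarrow> j < 2 * h \<Longrightarrow> level_of D u (Some j) = level j k x y"
  by (simp add: D_def)

lemma runE:
  assumes "u < length L"
  obtains k x y where "L ! u = (k,x,y)" "k < h" "(x,y) \<in> pairs"
proof (cases "L ! u")
  case (fields k x y)
  then have "(k,x,y) \<in> set L" using assms by (metis nth_mem)
  then show ?thesis using that fields set_L by simp
qed

lemma is_plan_D: "is_plan s (2 * h) D"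
  unfolding is_plan_def D_def using set_L by (auto simp: level_def)

lemma sum_over_runs:
  "(\<Sum>u<length D. f (L ! u)) = (\<Sum>(x,y)\<in>pairs. \<Sum>k<h. f (k,x,y) :: real)"
proof -
  have "(\<Sum>u<length D. f (L ! u)) = sum f (set L)"
    unfolding length_D by (rule sum.reindex_bij_betw[OF bij_betw_nth[OF distinct_L]]) auto
  also have "\<dots> = (\<Sum>k<h. \<Sum>p\<in>pairs. f (k,p))"
    unfolding set_L by (subst sum.cartesian_product) simp
  also have "\<dots> = (\<Sum>p\<in>pairs. \<Sum>k<h. f (k,p))"
    by (rule sum.swap)
  finally show ?thesis by (simp add: split_def)
qed

lemma choice_sign_cases: "j < 2 * h \<Longrightarrow> k < h \<Longrightarrow> choice_sign j k x y = 1 \<or> choice_sign j k x y = -1"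
  using e_sign[of "j div 2" k] by (auto simp: choice_sign_def flip_def)

text \<open>The decomposition behind the whole argument: the first summand is additive in the factors \<open>0\<close> and
\<open>1\<close>, and the sign enters the second one only.\<close>

lemma level_split:
  fixes F :: "nat \<Rightarrow> real"
  assumes "j < 2 * h" "k < h"
  shows "F (level j k x y) = (F x + F y) / 2 + choice_sign j k x y * (F x - F y) / 2"
  using choice_sign_cases[OF assms, of x y] by (auto simp: level_def field_simps)

lemma level_0: "k < h \<Longrightarrow> level 0 k x y = x"
  using e_0 by (simp add: level_def choice_sign_def flip_def)

lemma level_1: "k < h \<Longrightarrow> level 1 k x y = y"
  using e_0 by (simp add: level_def choice_sign_def flip_def)

lemma sum_e_choice_sign:
  assumes "i < h" "j < 2 * h"
  shows "(\<Sum>k<h. e i k * choice_sign j k x y) = (if j div 2 = i then real h * flip j x y else 0)"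
proof -
  have "(\<Sum>k<h. e i k * choice_sign j k x y) = (\<Sum>k<h. e i k * e (j div 2) k) * flip j x y"
    by (simp add: choice_sign_def sum_distrib_right mult.assoc)
  then show ?thesis using e_orth[of i "j div 2"] assms by auto
qed

lemma sum_choice_sign:
  assumes "j < 2 * h" "2 \<le> j"
  shows "(\<Sum>k<h. choice_sign j k x y) = 0"
  using sum_e_choice_sign[OF h assms(1), of x y] assms(2) e_0 by simp

lemma sum_choice_sign_mult:
  assumes "j < 2 * h" "j' < 2 * h"
  shows "(\<Sum>k<h. choice_sign j k x y * choice_sign j' k x y) =
    (if j div 2 = j' div 2 then real h * (flip j x y * flip j' x y) else 0)"
proof -
  have "(\<Sum>k<h. choice_sign j k x y * choice_sign j' k x y) = flip j x y * (\<Sum>k<h. e (j div 2) k * choice_sign j' k x y)"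
    by (simp add: choice_sign_def sum_distrib_left mult_ac)
  then show ?thesis using sum_e_choice_sign[of "j div 2" j'] assms by auto
qed

lemma antisymmetric_sum_zero:
  fixes f :: "nat \<Rightarrow> nat \<Rightarrow> real"
  assumes "\<And>x y. (x,y) \<in> pairs \<Longrightarrow> f y x = - f x y"
  shows "(\<Sum>(x,y)\<in>pairs. f x y) = 0"
proof -
  have "(\<Sum>(x,y)\<in>pairs. f x y) = (\<Sum>(x,y)\<in>pairs. f y x)"
    by (rule sum.reindex_bij_witness[of _ prod.swap prod.swap]) auto
  also have "\<dots> = (\<Sum>(x,y)\<in>pairs. - f x y)"
    using assms by (intro sum.cong) auto
  also have "\<dots> = - (\<Sum>(x,y)\<in>pairs. f x y)"
    by (simp add: sum_negf split_def)
  finally show ?thesis by simp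
qed

definition hit :: "nat \<Rightarrow> nat \<Rightarrow> real" where
  "hit t x = (if x = t then 1 else 0)"

text \<open>The general effect lies in the span of the factors \<open>0\<close> and \<open>1\<close>, so its residual is \<open>0\<close>.\<close>

fun residual :: "factor \<Rightarrow> nat \<Rightarrow> nat \<times> nat \<times> nat \<Rightarrow> real" where
  "residual None t (k,x,y) = 0"
| "residual (Some j) t (k,x,y) = choice_sign j k x y * (hit t x - hit t y) / 2"

lemma additive_minus_residual:
  assumes A: "A \<in> all_factors (2 * h)" and t: "t < levels s A"
  shows "additive_in D {Some 0, Some 1}
    (\<lambda>u. (if level_of D u A = t then 1 else 0) - residual A t (L ! u))"
proof (cases A)
  case None
  define g where "g = (\<lambda>C :: factor. \<lambda>_ :: nat. if C = Some 0 then 1 else 0 :: real)"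
  have "(if level_of D u A = t then 1 else 0) - residual A t (L ! u) =
      (\<Sum>B\<in>{Some 0, Some 1}. g B (level_of D u B))" if "u < length D" for u
    using None t by (cases "L ! u") (simp add: g_def)
  then show ?thesis unfolding additive_in_def by blast
next
  case (Some j)
  then have j: "j < 2 * h" using A by (auto simp: all_factors_def treatment_factors_def)
  define g where "g = (\<lambda>C :: factor. \<lambda>x. hit t x / 2)"
  have "(if level_of D u A = t then 1 else 0) - residual A t (L ! u) =
      (\<Sum>B\<in>{Some 0, Some 1}. g B (level_of D u B))" if "u < length D" for u
  proof -
    have u: "u < length L" using that by (simp add: length_D)
    then obtain k x y where L: "L ! u = (k,x,y)" and k: "k < h" by (rule runE)
    have lev: "level_of D u (Some i) = level i k x y" if "i < 2 * h" for i
      using level_of_D[OF u L that] .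
    have "(if level_of D u A = t then 1 else 0) = hit t (level j k x y)"
      unfolding Some lev[OF j] hit_def by simp
    also have "\<dots> = (hit t x + hit t y) / 2 + residual A t (L ! u)"
      using level_split[OF j k] by (simp add: Some L)
    finally have "(if level_of D u A = t then 1 else 0) - residual A t (L ! u) = hit t x / 2 + hit t y / 2"
      by (simp add: add_divide_distrib)
    also have "\<dots> = (\<Sum>B\<in>{Some 0, Some 1}. g B (level_of D u B))"
      using lev[of 0] lev[of 1] h k level_0[OF k, of x y] level_1[OF k, of x y]
      by (simp add: g_def del: level_of.simps)
    finally show ?thesis .
  qed
  then show ?thesis unfolding additive_in_def by blast
qed

lemma residual_orthogonal_to_pair:
  assumes A: "A \<in> all_factors (2 * h) - {Some 0, Some 1}" and C: "C \<in> {Some 0, Some 1}"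
  shows "(\<Sum>u<length D. g (level_of D u C) * residual A t (L ! u)) = 0"
proof (cases A)
  case None
  have "residual A t p = 0" for p using None by (cases p) simp
  then show ?thesis by simp
next
  case (Some j)
  then have j: "j < 2 * h" "2 \<le> j" using A by (auto simp: all_factors_def treatment_factors_def)
  \<comment> \<open>the level of \<open>C\<close> in a run \<open>(k, x, y)\<close>, which does not depend on \<open>k\<close>\<close>
  define z where "z = (\<lambda>(x,y). if C = Some 0 then x else y :: nat)"
  define F where "F = (\<lambda>(k,p). g (z p) * residual A t (k,p))"
  have "g (level_of D u C) * residual A t (L ! u) = F (L ! u)" if "u < length D" for u
  proof -
    have u: "u < length L" using that by (simp add: length_D)
    then obtain k x y where L: "L ! u = (k,x,y)" and k: "k < h" by (rule runE)
    have "level_of D u C = z (x,y)"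
      using C level_of_D[OF u L, of 0] level_of_D[OF u L, of 1] h level_0[OF k] level_1[OF k]
      by (auto simp: z_def simp del: level_of.simps)
    then show ?thesis by (simp add: F_def L del: level_of.simps)
  qed
  then have "(\<Sum>u<length D. g (level_of D u C) * residual A t (L ! u)) = (\<Sum>u<length D. F (L ! u))"
    by simp
  also have "\<dots> = (\<Sum>(x,y)\<in>pairs. \<Sum>k<h. F (k,x,y))" by (rule sum_over_runs)
  also have "\<dots> = (\<Sum>(x,y)\<in>pairs. g (z (x,y)) * (hit t x - hit t y) / 2 * (\<Sum>k<h. choice_sign j k x y))"
    by (simp add: F_def Some sum_distrib_left sum_divide_distrib split_def mult_ac)
  also have "\<dots> = 0" by (simp add: sum_choice_sign[OF j])
  finally show ?thesis .
qed

text \<open>The sum over \<open>k\<close> vanishes unless \<open>A\<close> and \<open>B\<close> come from the same row. In that case exactly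
one of the two signs is reversed for \<open>y < x\<close>, and the sum over \<open>(x, y)\<close> vanishes by
antisymmetry.\<close>

lemma residuals_orthogonal:
  assumes A: "A \<in> all_factors (2 * h) - {Some 0, Some 1}"
    and B: "B \<in> all_factors (2 * h) - {Some 0, Some 1}" and "A \<noteq> B"
  shows "(\<Sum>u<length D. residual A t (L ! u) * residual B t' (L ! u)) = 0"
proof (cases "A = None \<or> B = None")
  case True
  then have "residual A t p * residual B t' p = 0" for p by (cases p) auto
  then show ?thesis by simp
next
  case False
  then obtain i j where AB: "A = Some i" "B = Some j" by auto
  then have ij: "i < 2 * h" "2 \<le> i" "j < 2 * h" "2 \<le> j" "i \<noteq> j"
    using A B \<open>A \<noteq> B\<close> by (auto simp: all_factors_def treatment_factors_def)
  define w where "w x y = (hit t x - hit t y) * (hit t' x - hit t' y) / 4" for x y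
  have "(\<Sum>u<length D. residual A t (L ! u) * residual B t' (L ! u)) =
      (\<Sum>(x,y)\<in>pairs. \<Sum>k<h. residual A t (k,x,y) * residual B t' (k,x,y))"
    by (rule sum_over_runs)
  also have "\<dots> = (\<Sum>(x,y)\<in>pairs. w x y * (\<Sum>k<h. choice_sign i k x y * choice_sign j k x y))"
    by (simp add: AB w_def sum_distrib_left sum_divide_distrib split_def mult_ac)
  also have "\<dots> = (\<Sum>(x,y)\<in>pairs. w x y *
      (if i div 2 = j div 2 then real h * (flip i x y * flip j x y) else 0))"
    by (simp only: sum_choice_sign_mult[OF ij(1,3)])
  also have "\<dots> = 0"
  proof (cases "i div 2 = j div 2")
    case True
    then have "odd i \<noteq> odd j" using ij(5) by presburger
    then have anti: "flip i y x * flip j y x = - (flip i x y * flip j x y)" if "x \<noteq> y" for x y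
      using that ij by (auto simp: flip_def)
    have symm: "w y x = w x y" for x y by (simp add: w_def algebra_simps)
    show ?thesis
      unfolding if_P[OF True]
    proof (rule antisymmetric_sum_zero)
      fix x y assume "(x,y) \<in> pairs"
      then have "x \<noteq> y" by simp
      then show "w y x * (real h * (flip i y x * flip j y x)) = - (w x y * (real h * (flip i x y * flip j x y)))"
        unfolding anti[OF \<open>x \<noteq> y\<close>] symm[of y x] by simp
    qed
  qed (simp add: split_def)
  finally show ?thesis .
qed

lemma potp_D: "potp s (2 * h) D"
proof -
  let ?T = "{Some 0, Some 1} :: factor set"
  have "?T \<subseteq> treatment_factors (2 * h)" using h by (auto simp: treatment_factors_def)
  moreover have "card ?T = 2" by simp
  moreover have "orthogonal_through s D ?T A B"
    if "A \<in> all_factors (2 * h) - ?T" "B \<in> all_factors (2 * h) - ?T" "A \<noteq> B" for A B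
  proof (rule orthogonal_throughI[OF is_plan_D])
    show "?T \<subseteq> all_factors (2 * h)" using h by (auto simp: all_factors_def treatment_factors_def)
    show "additive_in D ?T (\<lambda>u. (if level_of D u A = t then 1 else 0) - residual A t (L ! u))"
      if "t < levels s A" for t
      using that \<open>A \<in> _\<close> by (intro additive_minus_residual) auto
    show "additive_in D ?T (\<lambda>u. (if level_of D u B = t then 1 else 0) - residual B t (L ! u))"
      if "t < levels s B" for t
      using that \<open>B \<in> _\<close> by (intro additive_minus_residual) auto
    show "(\<Sum>u<length D. g (level_of D u C) * residual B t (L ! u)) = 0" if "C \<in> ?T" for t C g
      by (rule residual_orthogonal_to_pair[OF \<open>B \<in> _\<close> that])
    show "(\<Sum>u<length D. residual A t (L ! u) * residual B t' (L ! u)) = 0" for t t'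
      by (rule residuals_orthogonal[OF that])
  qed (use that in auto)
  ultimately show ?thesis unfolding potp_def by blast
qed

text \<open>At fixed \<open>x\<close> and \<open>y\<close> a relation is a linear combination of rows of the Hadamard matrix, the mean part
belonging to row \<open>0\<close>. Orthogonality of the rows makes every coefficient zero.\<close>

lemma additive_relation_trivial:
  fixes G :: "factor \<Rightarrow> nat \<Rightarrow> real"
  assumes rel: "\<And>u. u < length D \<Longrightarrow> (\<Sum>B\<in>all_factors (2 * h). G B (level_of D u B)) = 0"
    and j: "j < 2 * h" and "x < s" "y < s"
  shows "G (Some j) x = G (Some j) y"
proof -
  define mean where "mean x y = G None 0 + (\<Sum>j<2 * h. (G (Some j) x + G (Some j) y) / 2)" for x y
  define d where "d j x y = G (Some j) x - G (Some j) y" for j x y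
  have run: "mean x y + (\<Sum>j<2 * h. choice_sign j k x y * d j x y / 2) = 0"
    if "k < h" and "(x,y) \<in> pairs" for k x y
  proof -
    have "(k,x,y) \<in> set L" using that set_L by simp
    then obtain u where u: "u < length L" "L ! u = (k,x,y)" by (metis in_set_conv_nth)
    have "0 = (\<Sum>B\<in>all_factors (2 * h). G B (level_of D u B))"
      using rel u by (simp add: length_D)
    also have "\<dots> = G None 0 + (\<Sum>j<2 * h. G (Some j) (level_of D u (Some j)))"
      unfolding all_factors_def treatment_factors_def
      by (subst sum.insert) (auto simp: sum.reindex)
    also have "\<dots> = G None 0 + (\<Sum>j<2 * h. (G (Some j) x + G (Some j) y) / 2 + choice_sign j k x y * d j x y / 2)"
      using level_of_D[OF u] level_split[OF _ that(1)] by (simp add: d_def del: level_of.simps)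
    also have "\<dots> = mean x y + (\<Sum>j<2 * h. choice_sign j k x y * d j x y / 2)"
      by (simp add: mean_def sum.distrib)
    finally show ?thesis by simp
  qed
  \<comment> \<open>correlate the relations \<open>run\<close> over all \<open>k\<close> with row \<open>i\<close>\<close>
  have row: "(if i = 0 then mean x y else 0) +
      (flip (2 * i) x y * d (2 * i) x y + flip (2 * i + 1) x y * d (2 * i + 1) x y) / 2 = 0"
    if i: "i < h" and xy: "(x,y) \<in> pairs" for i x y
  proof -
    have "0 = (\<Sum>k<h. e i k * (mean x y + (\<Sum>j<2 * h. choice_sign j k x y * d j x y / 2)))"
      using run[OF _ xy] by simp
    also have "\<dots> = mean x y * (\<Sum>k<h. e i k) +
        (\<Sum>k<h. \<Sum>j<2 * h. e i k * choice_sign j k x y * (d j x y / 2))"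
      by (simp add: distrib_left sum.distrib sum_distrib_left mult_ac)
    also have "(\<Sum>k<h. e i k) = (if i = 0 then real h else 0)"
      using e_orth[OF i h] e_0 by simp
    also have "(\<Sum>k<h. \<Sum>j<2 * h. e i k * choice_sign j k x y * (d j x y / 2)) =
        (\<Sum>j<2 * h. (\<Sum>k<h. e i k * choice_sign j k x y) * (d j x y / 2))"
      unfolding sum_distrib_right by (rule sum.swap)
    also have "\<dots> = (\<Sum>j<2 * h. if j div 2 = i then real h * flip j x y * (d j x y / 2) else 0)"
      using sum_e_choice_sign[OF i] by (intro sum.cong) auto
    also have "\<dots> = (\<Sum>j\<in>{2 * i, 2 * i + 1}. real h * flip j x y * (d j x y / 2))"
      using i by (intro sum.mono_neutral_cong_right) auto
    also have "\<dots> = real h * ((flip (2 * i) x y * d (2 * i) x y + flip (2 * i + 1) x y * d (2 * i + 1) x y) / 2)"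
      by (simp add: algebra_simps add_divide_distrib)
    finally have "real h * ((if i = 0 then mean x y else 0) +
      (flip (2 * i) x y * d (2 * i) x y + flip (2 * i + 1) x y * d (2 * i + 1) x y) / 2) = 0"
      by (simp add: algebra_simps split: if_splits)
    then show ?thesis using h by simp
  qed
  have const: "G (Some j) x = G (Some j) y" if j: "2 \<le> j" "j < 2 * h" and xy: "x < s" "y < s" for j x y
  proof (cases "x = y")
    case False
    define i where "i = j div 2"
    have i: "0 < i" "i < h" "j = 2 * i \<or> j = 2 * i + 1" using j by (auto simp: i_def)
    \<comment> \<open>the relations for \<open>(x, y)\<close> and \<open>(y, x)\<close> separate the two factors of the row\<close>
    have "d (2 * i) x y + (if y < x then -1 else 1) * d (2 * i + 1) x y = 0"
      "d (2 * i) y x + (if x < y then -1 else 1) * d (2 * i + 1) y x = 0"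
      using row[OF i(2), of x y] row[OF i(2), of y x] i xy False by (auto simp: flip_def)
    then show ?thesis using i(3) False by (auto simp: d_def split: if_splits)
  qed simp
  define K where "K = G None 0 + (\<Sum>j\<in>{2..<2 * h}. G (Some j) 0)"
  have pair: "G (Some 0) x + G (Some 1) y = - K" if xy: "(x,y) \<in> pairs" for x y
  proof -
    have "{..<2 * h} = insert 0 (insert 1 {2..<2 * h})" using h by auto
    then have "mean x y = G None 0 + (G (Some 0) x + G (Some 0) y) / 2 + (G (Some 1) x + G (Some 1) y) / 2
        + (\<Sum>j\<in>{2..<2 * h}. (G (Some j) x + G (Some j) y) / 2)"
      by (simp add: mean_def)
    also have "(\<Sum>j\<in>{2..<2 * h}. (G (Some j) x + G (Some j) y) / 2) = (\<Sum>j\<in>{2..<2 * h}. G (Some j) 0)"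
    proof (rule sum.cong)
      fix j assume "j \<in> {2..<2 * h}"
      then show "(G (Some j) x + G (Some j) y) / 2 = G (Some j) 0"
        using const[of j x 0] const[of j y 0] xy by simp
    qed simp
    finally have "mean x y = K + (G (Some 0) x + G (Some 0) y) / 2 + (G (Some 1) x + G (Some 1) y) / 2"
      by (simp add: K_def)
    then show ?thesis using row[OF h xy] by (simp add: flip_def d_def field_simps)
  qed
  \<comment> \<open>comparing two values of \<open>G (Some 0)\<close> or \<open>G (Some 1)\<close> through \<open>pair\<close> takes a third level\<close>
  obtain z where z: "z < s" "z \<noteq> x" "z \<noteq> y"
  proof -
    have "card {x, y} < card {..<s}" using s by (simp add: card_insert_if)
    then have "\<not> {..<s} \<subseteq> {x, y}" by (meson card_mono finite.emptyI finite.insertI not_less)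
    then show ?thesis using that by auto
  qed
  consider "j = 0" | "j = 1" | "2 \<le> j" by linarith
  then show ?thesis
  proof cases
    case 1
    then show ?thesis using pair[of x z] pair[of y z] z assms by simp
  next
    case 2
    then show ?thesis using pair[of z x] pair[of z y] z assms by simp
  next
    case 3
    then show ?thesis using const j assms(3,4) by blast
  qed
qed

lemma connected_D: "connected_plan s (2 * h) D"
proof (rule connected_planI[OF is_plan_D])
  fix A w t
  assume A: "A \<in> all_factors (2 * h)" and t: "t < levels s A"
    and add: "additive_in D (all_factors (2 * h) - {A}) (\<lambda>u. w (level_of D u A))"
  show "w t = w (levels s A - 1)"
  proof (cases A)
    case None
    then show ?thesis using t by simp
  next
    case (Some j)
    then have j: "j < 2 * h" using A by (auto simp: all_factors_def treatment_factors_def)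
    obtain g where g: "\<And>u. u < length D \<Longrightarrow>
        w (level_of D u A) = (\<Sum>B\<in>all_factors (2 * h) - {A}. g B (level_of D u B))"
      using add by (auto simp: additive_in_def)
    \<comment> \<open>move the function of \<open>A\<close> to the other side to get a relation between all factors\<close>
    define G where "G = g(A := \<lambda>t. - w t)"
    have "(\<Sum>B\<in>all_factors (2 * h). G B (level_of D u B)) = 0" if "u < length D" for u
    proof -
      have "(\<Sum>B\<in>all_factors (2 * h). G B (level_of D u B)) =
          - w (level_of D u A) + (\<Sum>B\<in>all_factors (2 * h) - {A}. G B (level_of D u B))"
        using A by (subst sum.remove[OF finite_all_factors A]) (simp add: G_def)
      also have "(\<Sum>B\<in>all_factors (2 * h) - {A}. G B (level_of D u B)) =
          (\<Sum>B\<in>all_factors (2 * h) - {A}. g B (level_of D u B))"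
        by (rule sum.cong) (auto simp: G_def)
      finally show ?thesis using g[OF that] by simp
    qed
    then have "G (Some j) t = G (Some j) (s - 1)"
      using additive_relation_trivial[of G j t "s - 1"] j t Some s by simp
    then show ?thesis using Some by (simp add: G_def)
  qed
qed (use h s in auto)

lemma length_D_eq: "length D = h * (s * (s - 1))"
proof -
  have "pairs = {..<s} \<times> {..<s} - (\<lambda>x. (x,x)) ` {..<s}" by auto
  then have "card pairs = s * s - s"
    by (simp add: card_Diff_subset card_image inj_on_def image_subset_iff)
  then show ?thesis
    using distinct_card[OF distinct_L] set_L by (simp add: length_D card_cartesian_product diff_mult_distrib2)
qed

end

theorem exists_potp_of_hadamard:
  assumes h: "0 < h" and H: "hadamard h H" and s: "3 \<le> s"
  shows "\<exists>D. is_plan s (2 * h) D \<and> length D = h * (s * (s - 1)) \<and>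
    connected_plan s (2 * h) D \<and> potp s (2 * h) D"
proof -
  have Hc: "H \<in> carrier_mat h h" and HH: "H * H\<^sup>T = of_nat h \<cdot>\<^sub>m 1\<^sub>m h"
    and sign: "\<And>i j. i < h \<Longrightarrow> j < h \<Longrightarrow> H $$ (i,j) = 1 \<or> H $$ (i,j) = -1"
    using H by (auto simp: hadamard_def)
  \<comment> \<open>changing signs of columns makes row \<open>0\<close> constant\<close>
  define e where "e i k = real_of_int (H $$ (i,k) * H $$ (0,k))" for i k
  have orth: "(\<Sum>k<h. e i k * e i' k) = (if i = i' then real h else 0)" if i: "i < h" "i' < h" for i i'
  proof -
    have "(\<Sum>k<h. e i k * e i' k) = (\<Sum>k<h. real_of_int (H $$ (i,k) * H $$ (i',k)))"
    proof (rule sum.cong)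
      fix k assume "k \<in> {..<h}"
      then show "e i k * e i' k = real_of_int (H $$ (i,k) * H $$ (i',k))"
        using sign[of 0 k] h by (auto simp: e_def)
    qed simp
    also have "\<dots> = real_of_int ((H * H\<^sup>T) $$ (i,i'))"
      using Hc i by (simp add: scalar_prod_def lessThan_atLeast0)
    also have "\<dots> = (if i = i' then real h else 0)"
      using i by (simp add: HH)
    finally show ?thesis .
  qed
  have "finite ({..<h} \<times> {(x,y). x < s \<and> y < s \<and> x \<noteq> y})"
    by (rule finite_subset[of _ "{..<h} \<times> {..<s} \<times> {..<s}"]) auto
  then obtain L where L: "set L = {..<h} \<times> {(x,y). x < s \<and> y < s \<and> x \<noteq> y}" "distinct L"
    using finite_distinct_list by blast
  interpret swap_plan h s e L
  proof
    show "e i k = 1 \<or> e i k = -1" if "i < h" "k < h" for i k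
      using sign[OF that] sign[OF h that(2)] by (auto simp: e_def)
    show "e 0 k = 1" if "k < h" for k
      using sign[OF h that] by (auto simp: e_def)
  qed (use h s orth L in auto)
  show ?thesis using is_plan_D length_D_eq connected_D potp_D by blast
qed

theorem theorem4p2:
  fixes h s :: nat
  assumes "0 < h" and "[h = 0] (mod 4)" and "\<exists>H. hadamard h H"
    and "primepow s" and "[s = 3] (mod 4)"
  shows "\<exists>D. is_plan s (2 * h) D \<and> length D = (2 * h * s * (s - 1)) div 2 \<and>
    connected_plan s (2 * h) D \<and> potp s (2 * h) D"
proof -
  have "3 \<le> s" using \<open>[s = 3] (mod 4)\<close> mod_less_eq_dividend[of s 4] by (simp add: cong_def)
  moreover have "(2 * h * s * (s - 1)) div 2 = h * (s * (s - 1))" by (simp add: mult.assoc)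
  ultimately show ?thesis using exists_potp_of_hadamard assms(1,3) by metis
qed

end
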